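(* Let $(X,\|\cdot\|)$ be a Banach space, let $x_0\in X$, $r>0$, and $B=B(x_0,r):=\{x\in X:\|x-x_0\|<r\}$. Let $b\in[0,\infty)$, $\theta\in[0,b+1)$, and let $T:B\to X$ be a $(b,\theta)$-enriched contraction, i.e. $\|b(x-y)+Tx-Ty\|\le\theta\|x-y\|$ for all $x,y\in B$. If $\|Tx_0-x_0\|<(b+1-\theta)r$, then $T$ has a fixed point, i.e. there exists $p\in B$ with $Tp=p$.
   Context: Let $(X,\|\cdot\|)$ be a linear normed space, $B\subseteq X$, $b\in[0,\infty)$ and $\theta\in[0,b+1)$. A mapping $T:B\to X$ is a $(b,\theta)$-enriched contraction if $\|b(x-y)+Tx-Ty\|\le\theta\|x-y\|$ for all $x,y\in B$. *)

theory Defs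
  imports "HOL-Analysis.Analysis"
begin

(* A mapping T : B \<rightarrow> X is modelled by a total function of which only the values on B matter.
   The parameters are meant to satisfy 0 \<le> b and 0 \<le> \<theta> < b + 1; this is assumed where the
   notion is used. *)
definition enriched_contraction_on ::
  "'a::real_normed_vector set \<Rightarrow> real \<Rightarrow> real \<Rightarrow> ('a \<Rightarrow> 'a) \<Rightarrow> bool" where
  "enriched_contraction_on B b \<theta> T \<longleftrightarrow>
     (\<forall>x\<in>B. \<forall>y\<in>B. norm (b *\<^sub>R (x - y) + T x - T y) \<le> \<theta> * norm (x - y))"

end

theory Submission
  imports Defs
begin

text \<open>
  For \<open>b \<ge> 0\<close> the averaged map \<open>S x = (b x + T x) / (b + 1)\<close> has the same fixed points
  as \<open>T\<close>, and the enriched contraction inequality for \<open>T\<close>, divided by \<open>b + 1\<close>, is the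
  ordinary contraction inequality for \<open>S\<close> with constant \<open>c = \<theta> / (b + 1) < 1\<close>
  (lemmas \<open>averaged_map_fixed_iff\<close> and \<open>averaged_map_contraction\<close>). Since
  \<open>S x0 - x0 = (T x0 - x0) / (b + 1)\<close>, the smallness assumption on \<open>T x0 - x0\<close> becomes
  \<open>norm (S x0 - x0) < (1 - c) r\<close>, so the local form of the Banach contraction principle on
  an open ball (\<open>contraction_on_ball_fixpoint\<close>) produces the fixed point.
\<close>

text \<open>
  A contraction that moves the centre of an open ball by little maps a smaller closed ball,
  which is complete, into itself: for \<open>x\<close> at distance at most \<open>\<rho>\<close> from \<open>x0\<close>, the
  distance from \<open>S x\<close> to \<open>x0\<close> is at most \<open>c \<rho> + dist (S x0) x0\<close>, and this equals \<open>\<rho>\<close>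
  when \<open>\<rho> = dist (S x0) x0 / (1 - c)\<close>.
\<close>

lemma contraction_on_ball_fixpoint:
  fixes x0 :: "'a::complete_space" and S :: "'a \<Rightarrow> 'a"
  assumes c: "0 \<le> c" "c < 1"
    and contr: "\<And>x y. x \<in> ball x0 r \<Longrightarrow> y \<in> ball x0 r \<Longrightarrow> dist (S x) (S y) \<le> c * dist x y"
    and small: "dist (S x0) x0 < (1 - c) * r"
  shows "\<exists>p\<in>ball x0 r. S p = p"
proof -
  define \<rho> where "\<rho> = dist (S x0) x0 / (1 - c)"
  have \<rho>0: "0 \<le> \<rho>"
    using c by (simp add: \<rho>_def)
  have \<rho>r: "\<rho> < r"
    using c small by (simp add: \<rho>_def pos_divide_less_eq mult.commute)
  have \<rho>_eq: "c * \<rho> + dist (S x0) x0 = \<rho>"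
    using c by (simp add: \<rho>_def field_simps)
  have sub: "cball x0 \<rho> \<subseteq> ball x0 r"
    using \<rho>r by auto
  have maps: "S ` cball x0 \<rho> \<subseteq> cball x0 \<rho>"
  proof clarify
    fix x assume x: "x \<in> cball x0 \<rho>"
    have "dist (S x) x0 \<le> dist (S x) (S x0) + dist (S x0) x0"
      by (rule dist_triangle)
    also have "dist (S x) (S x0) \<le> c * dist x x0"
      using contr[of x x0] x \<rho>0 \<rho>r by auto
    also have "c * dist x x0 \<le> c * \<rho>"
      using x c by (intro mult_left_mono) (auto simp: dist_commute)
    finally show "S x \<in> cball x0 \<rho>"
      using \<rho>_eq by (simp add: dist_commute)
  qed
  have "\<exists>!p\<in>cball x0 \<rho>. S p = p"
  proof (rule Banach_fix[OF _ _ c maps])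
    show "complete (cball x0 \<rho>)"
      by (simp add: complete_eq_closed)
    show "cball x0 \<rho> \<noteq> {}"
      using \<rho>0 by simp
    show "dist (S x) (S y) \<le> c * dist x y"
      if "x \<in> cball x0 \<rho>" "y \<in> cball x0 \<rho>" for x y
      using that sub contr by blast
  qed
  then show ?thesis
    using sub by blast
qed

definition averaged_map :: "real \<Rightarrow> ('a::real_normed_vector \<Rightarrow> 'a) \<Rightarrow> 'a \<Rightarrow> 'a" where
  "averaged_map b T x = (b *\<^sub>R x + T x) /\<^sub>R (b + 1)"

lemma averaged_map_diff_self:
  assumes "b \<ge> 0"
  shows "averaged_map b T x - x = (T x - x) /\<^sub>R (b + 1)"
proof -
  have "x = ((b + 1) *\<^sub>R x) /\<^sub>R (b + 1)"
    using assms by simp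
  then have "averaged_map b T x - x = (b *\<^sub>R x + T x) /\<^sub>R (b + 1) - ((b + 1) *\<^sub>R x) /\<^sub>R (b + 1)"
    by (simp only: averaged_map_def)
  also have "\<dots> = (T x - x) /\<^sub>R (b + 1)"
    unfolding scaleR_diff_right[symmetric] by (simp add: scaleR_add_left)
  finally show ?thesis .
qed

lemma averaged_map_fixed_iff:
  assumes "b \<ge> 0"
  shows "averaged_map b T x = x \<longleftrightarrow> T x = x"
  using averaged_map_diff_self[OF assms, of T x] assms
  by (metis add_nonneg_eq_0_iff inverse_nonzero_iff_nonzero right_minus_eq scaleR_eq_0_iff
      zero_le_one zero_neq_one)

lemma averaged_map_contraction:
  assumes "b \<ge> 0" and T: "enriched_contraction_on B b \<theta> T" and xy: "x \<in> B" "y \<in> B"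
  shows "dist (averaged_map b T x) (averaged_map b T y) \<le> \<theta> / (b + 1) * dist x y"
proof -
  have "averaged_map b T x - averaged_map b T y = (b *\<^sub>R (x - y) + T x - T y) /\<^sub>R (b + 1)"
    unfolding averaged_map_def scaleR_diff_right[symmetric] by (simp add: algebra_simps)
  then have "dist (averaged_map b T x) (averaged_map b T y)
      = norm (b *\<^sub>R (x - y) + T x - T y) / (b + 1)"
    using assms(1) by (simp add: dist_norm divide_inverse mult.commute)
  also have "\<dots> \<le> \<theta> * norm (x - y) / (b + 1)"
    using T xy assms(1) by (intro divide_right_mono) (auto simp: enriched_contraction_on_def)
  finally show ?thesis
    by (simp add: dist_norm)
qed

theorem corollary2:
  fixes x0 :: "'a::banach" and r b \<theta> :: real and B :: "'a set" and T :: "'a \<Rightarrow> 'a"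
  assumes "r > 0"
    and "B = {x. norm (x - x0) < r}"
    and "b \<ge> 0"
    and "0 \<le> \<theta>" and "\<theta> < b + 1"
    and "enriched_contraction_on B b \<theta> T"
    and "norm (T x0 - x0) < (b + 1 - \<theta>) * r"
  shows "\<exists>p\<in>B. T p = p"
proof -
  have B: "B = ball x0 r"
    using assms(2) by (auto simp: dist_norm norm_minus_commute)
  have "\<exists>p\<in>ball x0 r. averaged_map b T p = p"
  proof (rule contraction_on_ball_fixpoint[where c = "\<theta> / (b + 1)"])
    show "0 \<le> \<theta> / (b + 1)" "\<theta> / (b + 1) < 1"
      using assms(3-5) by auto
    show "dist (averaged_map b T x) (averaged_map b T y) \<le> \<theta> / (b + 1) * dist x y"
      if "x \<in> ball x0 r" "y \<in> ball x0 r" for x y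
      using averaged_map_contraction[OF assms(3,6)] that B by blast
    have "dist (averaged_map b T x0) x0 = norm (T x0 - x0) / (b + 1)"
      using assms(3) by (simp add: dist_norm averaged_map_diff_self divide_inverse mult.commute)
    also have "\<dots> < (b + 1 - \<theta>) * r / (b + 1)"
      using assms(3,7) by (intro divide_strict_right_mono) auto
    also have "\<dots> = (1 - \<theta> / (b + 1)) * r"
      using assms(3) by (simp add: field_simps)
    finally show "dist (averaged_map b T x0) x0 < (1 - \<theta> / (b + 1)) * r" .
  qed
  then show ?thesis
    using B averaged_map_fixed_iff[OF assms(3)] by blast
qed

end
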